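(* Let $\alpha$ be a nonzero integer and let $(h_n)$ be the sequence with $h_0=0$, $h_1=1$, $h_2=-\alpha$, $h_3=-\alpha^3$, $h_4=\alpha^6$, and for $m\ge2$: $h_{2m+1}=h_{m+2}h_m^3-h_{m-1}h_{m+1}^3$, for $m\ge 3$: $h_{2m}=h_m\big(h_{m+2}h_{m-1}^2-h_{m-2}h_{m+1}^2\big)/h_2$. (i) $h_n$ is a square for all positive integers $n$ not divisible by $5$ if and only if $\alpha$ is a square. (ii) $h_n$ is a cube for all positive integers $n$ not divisible by $5$ if and only if $\alpha$ is a cube.
   Context: The sequence defined is the elliptic divisibility sequence attached to the point $(0,0)$ of order $5$ on $y^2+(1-\alpha)xy-\alpha y=x^3-\alpha x^2$; $h_n=0$ exactly when $5\mid n$. Convention: an integer $m$ is called a square if $m=\pm\beta^2$ for some nonzero integer $\beta$, and a cube if $m=\beta^3$ for some nonzero integer $\beta$. *)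

theory Defs
  imports Complex_Main
begin

definition is_square_int :: "int \<Rightarrow> bool" where
  "is_square_int m \<longleftrightarrow> (\<exists>b::int. b \<noteq> 0 \<and> (m = b ^ 2 \<or> m = - (b ^ 2)))"

definition is_cube_int :: "int \<Rightarrow> bool" where
  "is_cube_int m \<longleftrightarrow> (\<exists>b::int. b \<noteq> 0 \<and> m = b ^ 3)"

end

theory Submission
  imports Defs
begin

text \<open>
  Up to sign, \<open>h n\<close> is a power of \<open>\<alpha>\<close> with exponent \<open>2 * n\<^sup>2 div 5\<close>, unless \<open>5 dvd n\<close>.
  The explicit sequence is quasi-periodic: shifting the index by \<open>5 * k\<close> multiplies it by
  \<open>(-1) ^ k * \<alpha> ^ (10 * k\<^sup>2 + 4 * k * n)\<close>. Both recurrences are homogeneous with respect to these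
  factors, so they have to be checked for five consecutive indices only. Powers of a square or cube
  are squares or cubes; conversely, \<open>h 2 = - \<alpha>\<close> already determines \<open>\<alpha>\<close>.
\<close>

section \<open>The explicit sequence and its quasi-periodicity\<close>

definition eds5_sign :: "nat \<Rightarrow> int" where
  "eds5_sign n = (-1) ^ (n div 5) *
     (if n mod 5 = 0 then 0 else if n mod 5 = 1 \<or> n mod 5 = 4 then 1 else - 1)"

text \<open>The zeros of \<open>eds5_sign\<close> make the terms at multiples of 5 vanish. The ring
  is left general because \<open>h\<close> is rational, its recurrence dividing by
  \<open>h 2\<close>, while squares and cubes are sought among the same terms over the
  integers.\<close>

definition eds5 :: "'a::comm_ring_1 \<Rightarrow> nat \<Rightarrow> 'a" where
  "eds5 a n = of_int (eds5_sign n) * a ^ (2 * n\<^sup>2 div 5)"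

lemma eds5_sign_cases:
  assumes "\<not> 5 dvd n"
  shows "eds5_sign n = 1 \<or> eds5_sign n = - 1"
proof -
  have "n mod 5 \<noteq> 0"
    using assms by (simp add: dvd_eq_mod_eq_0)
  moreover have "(-1 :: int) ^ (n div 5) = 1 \<or> (-1 :: int) ^ (n div 5) = - 1"
    by (cases "even (n div 5)") auto
  ultimately show ?thesis
    unfolding eds5_sign_def by auto
qed

text \<open>In the expanded square every term containing \<open>k\<close> is a multiple of 5, so it
  leaves the floor exactly; \<open>k\<close> further blocks of five contribute the sign.\<close>

lemma eds5_shift:
  "eds5 a (5 * k + n) = (-1) ^ k * a ^ (10 * k\<^sup>2 + 4 * k * n) * eds5 a n"
proof -
  have "2 * (5 * k + n)\<^sup>2 = 5 * (10 * k\<^sup>2 + 4 * k * n) + 2 * n\<^sup>2"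
    by (simp add: power2_eq_square algebra_simps)
  then have "2 * (5 * k + n)\<^sup>2 div 5 = (10 * k\<^sup>2 + 4 * k * n) + 2 * n\<^sup>2 div 5"
    by simp
  moreover have "eds5_sign (5 * k + n) = (-1) ^ k * eds5_sign n"
    by (simp add: eds5_sign_def power_add)
  ultimately show ?thesis
    by (simp add: eds5_def power_add mult_ac)
qed

text \<open>For base indices 2 to 6 the two recurrences reach from index 0 up to index 13 = 2 * 6 +
  1.\<close>

lemma eds5_initial_values:
  "eds5 a 0 = 0"
  "eds5 a (Suc 0) = 1"
  "eds5 a 2 = - a"
  "eds5 a 3 = - (a ^ 3)"
  "eds5 a 4 = a ^ 6"
  "eds5 a 5 = 0"
  "eds5 a 6 = - (a ^ 14)"
  "eds5 a 7 = a ^ 19"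
  "eds5 a 8 = a ^ 25"
  "eds5 a 9 = - (a ^ 32)"
  "eds5 a 10 = 0"
  "eds5 a 11 = a ^ 48"
  "eds5 a 12 = - (a ^ 57)"
  "eds5 a 13 = - (a ^ 67)"
  by (simp_all add: eds5_def eds5_sign_def)

section \<open>The two recurrences for the explicit sequence\<close>

lemma index_decomposition:
  fixes m :: nat
  assumes "m \<ge> 2"
  obtains k i where "m = 5 * k + i" and "i \<in> {2, 3, 4, 5, 6}"
proof
  \<comment> \<open>Representatives from 2 to 6 instead of 0 to 4 keep \<open>i - 1\<close> and
    \<open>i - 2\<close> free of truncation.\<close>
  show "m = 5 * ((m - 2) div 5) + ((m - 2) mod 5 + 2)"
    using assms by presburger
  have "(m - 2) mod 5 < 5"
    by simp
  then show "(m - 2) mod 5 + 2 \<in> {2, 3, 4, 5, 6}"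
    by simp linarith
qed

text \<open>Each product on the right has four factors, so its sign is \<open>u ^ 4 = 1\<close>.
  Their indices sum to \<open>4 * i + 2\<close> in both products, so both acquire the same power of
  \<open>a\<close> under the shift.\<close>

lemma eds5_odd:
  fixes a :: "'a::comm_ring_1"
  assumes "m \<ge> 2"
  shows "eds5 a (2 * m + 1) = eds5 a (m + 2) * eds5 a m ^ 3 - eds5 a (m - 1) * eds5 a (m + 1) ^ 3"
proof -
  obtain k i where m: "m = 5 * k + i" and i: "i \<in> {2, 3, 4, 5, 6}"
    using index_decomposition assms by blast
  \<comment> \<open>For \<open>i = 2\<close> two equal monomials cancel; in every other case one
    product contains \<open>eds5 a 5 = 0\<close>.\<close>
  have base: "eds5 a (2 * i + 1)
      = eds5 a (i + 2) * eds5 a i ^ 3 - eds5 a (i - 1) * eds5 a (i + 1) ^ 3"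
    using i by (auto simp: eds5_initial_values simp flip: power_mult power_add power_Suc)
  define u where "u = (-1 :: 'a) ^ k"
  have u: "u * u = 1"
    by (simp add: u_def flip: power_mult_distrib)
  define A where "A j = a ^ (10 * k\<^sup>2 + 4 * k * j)" for j
  have shift: "eds5 a n = u * A j * eds5 a j" if "n = 5 * k + j" for n j
    by (simp add: that eds5_shift u_def A_def)
  \<comment> \<open>Substituting \<open>l + 2\<close> removes natural subtraction, so that exponents
    can be compared as polynomials.\<close>
  obtain l where l: "i = l + 2"
    using i le_Suc_ex[of 2 i] by (auto simp: add.commute)
  have shifts: "eds5 a (m + 2) = u * A (i + 2) * eds5 a (i + 2)"
    "eds5 a m = u * A i * eds5 a i"
    "eds5 a (m - 1) = u * A (i - 1) * eds5 a (i - 1)"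
    "eds5 a (m + 1) = u * A (i + 1) * eds5 a (i + 1)"
    by (rule shift; simp add: m l)+
  \<comment> \<open>This is the shift factor for
    \<open>2 * m + 1 = 5 * (2 * k) + (2 * i + 1)\<close>, whose sign is 1.\<close>
  define c where "c = a ^ (40 * k\<^sup>2 + 8 * k * (2 * i + 1))"
  have lhs: "eds5 a (2 * m + 1) = c * eds5 a (2 * i + 1)"
    using eds5_shift[of a "2 * k" "2 * i + 1"]
    by (simp add: m c_def power_mult_distrib algebra_simps)
  have t1: "eds5 a (m + 2) * eds5 a m ^ 3
      = c * (eds5 a (i + 2) * eds5 a i ^ 3)"
  proof -
    have "eds5 a (m + 2) * eds5 a m ^ 3
        = (u * u) * (u * u) * (A (i + 2) * A i ^ 3) * (eds5 a (i + 2) * eds5 a i ^ 3)"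
      unfolding shifts by (simp only: power3_eq_cube power2_eq_square mult_ac)
    also have "A (i + 2) * A i ^ 3 = c"
      unfolding A_def c_def l by (simp add: algebra_simps flip: power_mult power_add)
    finally show ?thesis
      by (simp add: u)
  qed
  have t2: "eds5 a (m - 1) * eds5 a (m + 1) ^ 3
      = c * (eds5 a (i - 1) * eds5 a (i + 1) ^ 3)"
  proof -
    have "eds5 a (m - 1) * eds5 a (m + 1) ^ 3
        = (u * u) * (u * u) * (A (i - 1) * A (i + 1) ^ 3) * (eds5 a (i - 1) * eds5 a (i + 1) ^ 3)"
      unfolding shifts by (simp only: power3_eq_cube power2_eq_square mult_ac)
    also have "A (i - 1) * A (i + 1) ^ 3 = c"
      unfolding A_def c_def l by (simp add: algebra_simps flip: power_mult power_add)
    finally show ?thesis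
      by (simp add: u)
  qed
  show ?thesis
    unfolding lhs t1 t2 base by (simp add: algebra_simps)
qed

text \<open>Multiplying through by \<open>h 2\<close>, here \<open>- a\<close>, avoids division. The
  homogeneity is as in the odd case: both products have four factors with index sum
  \<open>4 * i\<close>.\<close>

lemma eds5_even:
  fixes a :: "'a::comm_ring_1"
  assumes "m \<ge> 2"
  shows "- a * eds5 a (2 * m)
    = eds5 a m * (eds5 a (m + 2) * eds5 a (m - 1) ^ 2 - eds5 a (m - 2) * eds5 a (m + 1) ^ 2)"
proof -
  obtain k i where m: "m = 5 * k + i" and i: "i \<in> {2, 3, 4, 5, 6}"
    using index_decomposition assms by blast
  have base: "- a * eds5 a (2 * i)
      = eds5 a i * (eds5 a (i + 2) * eds5 a (i - 1) ^ 2 - eds5 a (i - 2) * eds5 a (i + 1) ^ 2)"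
    using i by (auto simp: eds5_initial_values simp flip: power_mult power_add power_Suc)
  define u where "u = (-1 :: 'a) ^ k"
  have u: "u * u = 1"
    by (simp add: u_def flip: power_mult_distrib)
  define A where "A j = a ^ (10 * k\<^sup>2 + 4 * k * j)" for j
  have shift: "eds5 a n = u * A j * eds5 a j" if "n = 5 * k + j" for n j
    by (simp add: that eds5_shift u_def A_def)
  obtain l where l: "i = l + 2"
    using i le_Suc_ex[of 2 i] by (auto simp: add.commute)
  have shifts: "eds5 a m = u * A i * eds5 a i"
    "eds5 a (m + 2) = u * A (i + 2) * eds5 a (i + 2)"
    "eds5 a (m - 1) = u * A (i - 1) * eds5 a (i - 1)"
    "eds5 a (m - 2) = u * A (i - 2) * eds5 a (i - 2)"
    "eds5 a (m + 1) = u * A (i + 1) * eds5 a (i + 1)"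
    by (rule shift; simp add: m l)+
  define c where "c = a ^ (40 * k\<^sup>2 + 16 * k * i)"
  have lhs: "eds5 a (2 * m) = c * eds5 a (2 * i)"
    using eds5_shift[of a "2 * k" "2 * i"]
    by (simp add: m c_def power_mult_distrib algebra_simps)
  have t1: "eds5 a m * (eds5 a (m + 2) * eds5 a (m - 1) ^ 2)
      = c * (eds5 a i * (eds5 a (i + 2) * eds5 a (i - 1) ^ 2))"
  proof -
    have "eds5 a m * (eds5 a (m + 2) * eds5 a (m - 1) ^ 2)
        = (u * u) * (u * u) * (A i * A (i + 2) * A (i - 1) ^ 2)
          * (eds5 a i * (eds5 a (i + 2) * eds5 a (i - 1) ^ 2))"
      unfolding shifts by (simp only: power3_eq_cube power2_eq_square mult_ac)
    also have "A i * A (i + 2) * A (i - 1) ^ 2 = c"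
      unfolding A_def c_def l by (simp add: algebra_simps flip: power_mult power_add)
    finally show ?thesis
      by (simp add: u)
  qed
  have t2: "eds5 a m * (eds5 a (m - 2) * eds5 a (m + 1) ^ 2)
      = c * (eds5 a i * (eds5 a (i - 2) * eds5 a (i + 1) ^ 2))"
  proof -
    have "eds5 a m * (eds5 a (m - 2) * eds5 a (m + 1) ^ 2)
        = (u * u) * (u * u) * (A i * A (i - 2) * A (i + 1) ^ 2)
          * (eds5 a i * (eds5 a (i - 2) * eds5 a (i + 1) ^ 2))"
      unfolding shifts by (simp only: power3_eq_cube power2_eq_square mult_ac)
    also have "A i * A (i - 2) * A (i + 1) ^ 2 = c"
      unfolding A_def c_def l by (simp add: algebra_simps flip: power_mult power_add)
    finally show ?thesis
      by (simp add: u)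
  qed
  have "- a * eds5 a (2 * m) = c * (- a * eds5 a (2 * i))"
    unfolding lhs by (rule mult.left_commute)
  also have "\<dots> = eds5 a m * (eds5 a (m + 2) * eds5 a (m - 1) ^ 2)
      - eds5 a m * (eds5 a (m - 2) * eds5 a (m + 1) ^ 2)"
    unfolding base t1 t2 by (simp only: right_diff_distrib)
  finally show ?thesis
    by (simp only: right_diff_distrib)
qed

section \<open>Identification of the given sequence with the explicit one\<close>

lemma eq_eds5:
  fixes a :: "'a::field" and h :: "nat \<Rightarrow> 'a"
  assumes "a \<noteq> 0"
    and init: "h 0 = 0" "h 1 = 1" "h 2 = - a" "h 3 = - (a ^ 3)" "h 4 = a ^ 6"
    and odd: "\<And>m. m \<ge> 2 \<Longrightarrow> h (2 * m + 1) = h (m + 2) * h m ^ 3 - h (m - 1) * h (m + 1) ^ 3"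
    and even: "\<And>m. m \<ge> 3 \<Longrightarrow>
      h (2 * m) = h m * (h (m + 2) * h (m - 1) ^ 2 - h (m - 2) * h (m + 1) ^ 2) / h 2"
  shows "h n = eds5 a n"
proof (induction n rule: less_induct)
  case (less n)
  \<comment> \<open>The largest index on the right is \<open>m + 2\<close>; it is below
    \<open>2 * m + 1\<close> for \<open>m \<ge> 2\<close> and below \<open>2 * m\<close> for
    \<open>m \<ge> 3\<close>, so strong induction applies.\<close>
  consider "n \<in> {0, 1, 2, 3, 4}" | m where "m \<ge> 2" "n = 2 * m + 1" | m where "m \<ge> 3" "n = 2 * m"
  proof -
    have "n \<in> {0, 1, 2, 3, 4} \<or> (n div 2 \<ge> 2 \<and> n = 2 * (n div 2) + 1)
        \<or> (n div 2 \<ge> 3 \<and> n = 2 * (n div 2))"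
      by simp presburger
    then show ?thesis
      using that by blast
  qed
  then show ?case
  proof cases
    case 1
    then show ?thesis
      using init by (auto simp: eds5_def eds5_sign_def)
  next
    case (2 m)
    then have "h (m + 2) = eds5 a (m + 2)" "h m = eds5 a m" "h (m - 1) = eds5 a (m - 1)"
      "h (m + 1) = eds5 a (m + 1)"
      using less by auto
    then show ?thesis
      using odd[of m] eds5_odd[of m a] 2 by simp
  next
    case (3 m)
    then have "h (m + 2) = eds5 a (m + 2)" "h m = eds5 a m" "h (m - 1) = eds5 a (m - 1)"
      "h (m + 1) = eds5 a (m + 1)" "h (m - 2) = eds5 a (m - 2)"
      using less by auto
    then have "h n = - a * eds5 a (2 * m) / h 2"
      using even[of m] eds5_even[of m a] 3 by simp
    then show ?thesis
      using 3 init \<open>a \<noteq> 0\<close> by simp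
  qed
qed

section \<open>Squares and cubes among the terms\<close>

lemma is_square_int_uminus [simp]: "is_square_int (- m) \<longleftrightarrow> is_square_int m"
  unfolding is_square_int_def by (metis minus_minus)

lemma is_square_int_power:
  assumes "is_square_int m"
  shows "is_square_int (m ^ e)"
proof -
  obtain b where "b \<noteq> 0" and b: "m = b ^ 2 \<or> m = - (b ^ 2)"
    using assms unfolding is_square_int_def by blast
  have "(b ^ 2) ^ e = (b ^ e) ^ 2"
    by (simp add: mult.commute flip: power_mult)
  then have "m ^ e = (b ^ e) ^ 2 \<or> m ^ e = - ((b ^ e) ^ 2)"
    using b by (cases "even e") auto
  then show ?thesis
    unfolding is_square_int_def using \<open>b \<noteq> 0\<close> by (intro exI[of _ "b ^ e"]) simp
qed

lemma is_cube_int_uminus [simp]: "is_cube_int (- m) \<longleftrightarrow> is_cube_int m"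
proof -
  have "is_cube_int (- k)" if "is_cube_int k" for k
  proof -
    obtain b where "b \<noteq> 0" "k = b ^ 3"
      using \<open>is_cube_int k\<close> unfolding is_cube_int_def by blast
    then show ?thesis
      unfolding is_cube_int_def by (intro exI[of _ "- b"]) simp
  qed
  from this[of m] this[of "- m"] show ?thesis
    by auto
qed

lemma is_cube_int_power:
  assumes "is_cube_int m"
  shows "is_cube_int (m ^ e)"
proof -
  obtain b where "b \<noteq> 0" "m = b ^ 3"
    using assms unfolding is_cube_int_def by blast
  then have "m ^ e = (b ^ e) ^ 3"
    by (simp add: mult.commute flip: power_mult)
  then show ?thesis
    unfolding is_cube_int_def using \<open>b \<noteq> 0\<close> by (intro exI[of _ "b ^ e"]) simp
qed

text \<open>Squares and cubes are handled together: invariance under sign and closure under powers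
  suffice.\<close>

lemma eds5_all_iff:
  fixes P :: "int \<Rightarrow> bool" and h :: "nat \<Rightarrow> rat"
  assumes h: "\<And>n. h n = eds5 (of_int a) n"
    and neg: "\<And>k. P (- k) \<longleftrightarrow> P k"
    and pow: "\<And>k e. P k \<Longrightarrow> P (k ^ e)"
  shows "(\<forall>n. n > 0 \<and> \<not> 5 dvd n \<longrightarrow> (\<exists>k. h n = of_int k \<and> P k)) \<longleftrightarrow> P a" (is "?L \<longleftrightarrow> _")
proof
  assume ?L
  then have "\<exists>k. h 2 = of_int k \<and> P k"
    by (elim allE[of _ 2]) simp
  then obtain k where "h 2 = of_int k" "P k"
    by blast
  moreover have "h 2 = of_int (- a)"
    by (simp add: h eds5_def eds5_sign_def)
  \<comment> \<open>The embedding of the integers in the rationals is injective, so \<open>k\<close>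
    is \<open>- a\<close>.\<close>
  ultimately have "P (- a)"
    by (metis of_int_eq_iff)
  then show "P a"
    by (simp add: neg)
next
  assume "P a"
  have "\<exists>k. h n = of_int k \<and> P k" if "\<not> 5 dvd n" for n
  proof (intro exI conjI)
    \<comment> \<open>The witness is the same formula evaluated over the integers, which
      \<open>of_int\<close> carries to the rational term.\<close>
    show "h n = of_int (eds5 a n)"
      by (simp add: h eds5_def)
    show "P (eds5 a n)"
      using eds5_sign_cases[OF that] pow[OF \<open>P a\<close>] by (auto simp: eds5_def neg)
  qed
  then show ?L
    by blast
qed

theorem theorem5p4:
  fixes \<alpha> :: int and h :: "nat \<Rightarrow> rat"
  assumes "\<alpha> \<noteq> 0"
    and "h 0 = 0"
    and "h 1 = 1"
    and "h 2 = - of_int \<alpha>"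
    and "h 3 = - (of_int \<alpha> ^ 3)"
    and "h 4 = of_int \<alpha> ^ 6"
    and "\<And>m. m \<ge> 2 \<Longrightarrow> h (2 * m + 1) = h (m + 2) * h m ^ 3 - h (m - 1) * h (m + 1) ^ 3"
    and "\<And>m. m \<ge> 3 \<Longrightarrow>
      h (2 * m) = h m * (h (m + 2) * h (m - 1) ^ 2 - h (m - 2) * h (m + 1) ^ 2) / h 2"
  shows "((\<forall>n::nat. n > 0 \<and> \<not> 5 dvd n \<longrightarrow> (\<exists>k::int. h n = of_int k \<and> is_square_int k))
            \<longleftrightarrow> is_square_int \<alpha>)
       \<and> ((\<forall>n::nat. n > 0 \<and> \<not> 5 dvd n \<longrightarrow> (\<exists>k::int. h n = of_int k \<and> is_cube_int k))
            \<longleftrightarrow> is_cube_int \<alpha>)"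
proof -
  have h: "h n = eds5 (of_int \<alpha>) n" for n
    using assms by (intro eq_eds5) auto
  show ?thesis
    using eds5_all_iff[of h \<alpha> is_square_int, OF h is_square_int_uminus is_square_int_power]
      eds5_all_iff[of h \<alpha> is_cube_int, OF h is_cube_int_uminus is_cube_int_power]
    by blast
qed

end
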